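(* Let $(\Xi,d)$ be a non-empty metric space and $f:\Xi\to\Xi$ a mapping. Suppose that: (a) if $\{\iota_n\}$ is a sequence in $\Xi$ such that, for all $p\in\mathbb{N}$, $d(\iota_n,\iota_{n+p})\to0$ as $n\to\infty$, then $\{\iota_n\}$ is convergent; (b) there exists $\zeta\in\Pi$ such that $\rho\, d(f\iota,f\kappa)\le\zeta(\rho)\,d(\iota,\kappa)$ for all $\iota,\kappa\in\Xi$ and $\rho>0$. Then $f$ possesses a unique fixed point $z$; moreover, the sequence $\{f^n\iota\}$ converges to $z$ for each $\iota\in\Xi$.
   Context: $\Pi$ denotes the set of all functions $\zeta:(0,\infty)\to(0,\infty)$ such that $\lim_{n\to\infty}\zeta^n(\rho)=0$ for all $\rho>0$, where $\zeta^n$ is the $n$-th iterate of $\zeta$. A fixed point of $f$ is a point $z\in\Xi$ with $fz=z$, and $f^n$ denotes the $n$-th iterate of $f$. *)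

theory Defs
  imports "HOL-Analysis.Abstract_Metric_Spaces"
begin

text \<open>
  Functions \<open>(0,\<infinity>) \<rightarrow> (0,\<infinity>)\<close> are represented by total functions on the reals that map
  \<open>(0,\<infinity>)\<close> into itself; values outside \<open>(0,\<infinity>)\<close> are never used.
\<close>

definition iter_null_funs :: "(real \<Rightarrow> real) set" where
  "iter_null_funs =
     {\<zeta> \<in> {0<..} \<rightarrow> {0<..}. \<forall>\<rho>>0. (\<lambda>n. (\<zeta> ^^ n) \<rho>) \<longlonglongrightarrow> 0}"

end

theory Submission
  imports Defs
begin

text \<open>
  The parameter \<open>\<rho>\<close> in (b) lets the hypothesis be composed with itself: applying it with \<open>\<rho>\<close>, then
  with \<open>\<zeta> \<rho>\<close>, then with \<open>\<zeta> (\<zeta> \<rho>)\<close> and so on yields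
  \<open>\<rho> d(f\<^sup>n\<iota>, f\<^sup>n\<kappa>) \<le> \<zeta>\<^sup>n(\<rho>) d(\<iota>, \<kappa>)\<close>. As \<open>\<zeta>\<^sup>n(1) \<rightarrow> 0\<close>, any two orbits approach each other
  (\<open>orbits_asymptotic\<close>). Comparing the orbit of \<open>\<iota>\<close> with
  that of \<open>f\<^sup>p\<iota>\<close> gives the premise of (a), so the orbit converges; its limit is fixed because (b) at
  \<open>\<rho> = 1\<close> makes \<open>f\<close> Lipschitz with constant \<open>\<zeta>(1)\<close>. The orbit of any other point approaches the
  constant orbit of the fixed point, which gives both global convergence and uniqueness.
\<close>

lemma funpow_mem_funcset:
  assumes "f \<in> A \<rightarrow> A" "x \<in> A"
  shows "(f ^^ n) x \<in> A"
  using assms by (induction n) auto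

lemma iterate_scaled_dist_le:
  fixes d :: "'a \<Rightarrow> 'a \<Rightarrow> real" and \<zeta> :: "real \<Rightarrow> real"
  assumes f: "f \<in> \<Xi> \<rightarrow> \<Xi>" and \<zeta>: "\<zeta> \<in> {0<..} \<rightarrow> {0<..}"
    and contr: "\<And>x y \<rho>. x \<in> \<Xi> \<Longrightarrow> y \<in> \<Xi> \<Longrightarrow> \<rho> > 0 \<Longrightarrow> \<rho> * d (f x) (f y) \<le> \<zeta> \<rho> * d x y"
    and "x \<in> \<Xi>" "y \<in> \<Xi>" "\<rho> > 0"
  shows "\<rho> * d ((f ^^ n) x) ((f ^^ n) y) \<le> (\<zeta> ^^ n) \<rho> * d x y"
  using \<open>\<rho> > 0\<close>
proof (induction n arbitrary: \<rho>)
  case 0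
  then show ?case by simp
next
  case (Suc n)
  have mem: "(f ^^ n) x \<in> \<Xi>" "(f ^^ n) y \<in> \<Xi>"
    using funpow_mem_funcset[OF f] \<open>x \<in> \<Xi>\<close> \<open>y \<in> \<Xi>\<close> by auto
  \<comment> \<open>The outermost \<open>f\<close> is peeled off with parameter \<open>\<rho>\<close>; the remaining iterates are then bounded
    with the new parameter \<open>\<zeta> \<rho>\<close>, so the induction must generalise over \<open>\<rho>\<close>.\<close>
  have "\<rho> * d ((f ^^ Suc n) x) ((f ^^ Suc n) y) \<le> \<zeta> \<rho> * d ((f ^^ n) x) ((f ^^ n) y)"
    using contr[OF mem Suc.prems] by simp
  also have "\<dots> \<le> (\<zeta> ^^ n) (\<zeta> \<rho>) * d x y"
    using Suc.IH \<zeta> Suc.prems by (auto simp: Pi_iff)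
  finally show ?case
    by (simp add: funpow_swap1)
qed

text \<open>
  Fixing \<open>\<rho> = 1\<close> in the iterated estimate puts the bounds \<open>\<zeta>\<^sup>n(1)\<close> in the role that the powers of
  a contraction constant play in the Banach fixed point theorem, so no constant below \<open>1\<close> has to be
  extracted from \<open>\<zeta>\<close>.
\<close>

lemma orbits_asymptotic:
  fixes d :: "'a \<Rightarrow> 'a \<Rightarrow> real"
  assumes M: "Metric_space \<Xi> d" and f: "f \<in> \<Xi> \<rightarrow> \<Xi>" and \<zeta>: "\<zeta> \<in> iter_null_funs"
    and contr: "\<And>x y \<rho>. x \<in> \<Xi> \<Longrightarrow> y \<in> \<Xi> \<Longrightarrow> \<rho> > 0 \<Longrightarrow> \<rho> * d (f x) (f y) \<le> \<zeta> \<rho> * d x y"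
    and "x \<in> \<Xi>" "y \<in> \<Xi>"
  shows "(\<lambda>n. d ((f ^^ n) x) ((f ^^ n) y)) \<longlonglongrightarrow> 0"
proof (rule tendsto_sandwich[OF always_eventually always_eventually tendsto_const])
  have \<zeta>_pos: "\<zeta> \<in> {0<..} \<rightarrow> {0<..}" and "(\<lambda>n. (\<zeta> ^^ n) 1) \<longlonglongrightarrow> 0"
    using \<zeta> by (auto simp: iter_null_funs_def)
  then show "(\<lambda>n. (\<zeta> ^^ n) 1 * d x y) \<longlonglongrightarrow> 0"
    by (auto intro: tendsto_mult_left_zero)
  show "\<forall>n. d ((f ^^ n) x) ((f ^^ n) y) \<le> (\<zeta> ^^ n) 1 * d x y"
    using iterate_scaled_dist_le[where d = d and \<rho> = 1, OF f \<zeta>_pos contr \<open>x \<in> \<Xi>\<close> \<open>y \<in> \<Xi>\<close>]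
    by simp
  show "\<forall>n. 0 \<le> d ((f ^^ n) x) ((f ^^ n) y)"
    using Metric_space.nonneg[OF M] by simp
qed

theorem theorem18:
  fixes \<Xi> :: "'a set" and d :: "'a \<Rightarrow> 'a \<Rightarrow> real" and f :: "'a \<Rightarrow> 'a"
  assumes "Metric_space \<Xi> d" and "\<Xi> \<noteq> {}" and "f \<in> \<Xi> \<rightarrow> \<Xi>"
    and "\<And>\<iota> :: nat \<Rightarrow> 'a. range \<iota> \<subseteq> \<Xi> \<Longrightarrow>
           (\<forall>p. (\<lambda>n. d (\<iota> n) (\<iota> (n + p))) \<longlonglongrightarrow> 0) \<Longrightarrow>
           (\<exists>l. limitin (Metric_space.mtopology \<Xi> d) \<iota> l sequentially)"
    and "\<exists>\<zeta> \<in> iter_null_funs. \<forall>\<iota>\<in>\<Xi>. \<forall>\<kappa>\<in>\<Xi>. \<forall>\<rho>>0. \<rho> * d (f \<iota>) (f \<kappa>) \<le> \<zeta> \<rho> * d \<iota> \<kappa>"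
  shows "\<exists>z\<in>\<Xi>. f z = z \<and> (\<forall>w\<in>\<Xi>. f w = w \<longrightarrow> w = z) \<and>
           (\<forall>\<iota>\<in>\<Xi>. limitin (Metric_space.mtopology \<Xi> d) (\<lambda>n. (f ^^ n) \<iota>) z sequentially)"
proof -
  interpret Metric_space \<Xi> d by fact
  note f = \<open>f \<in> \<Xi> \<rightarrow> \<Xi>\<close>
  obtain \<zeta> where \<zeta>: "\<zeta> \<in> iter_null_funs"
    and contr: "\<And>x y \<rho>. x \<in> \<Xi> \<Longrightarrow> y \<in> \<Xi> \<Longrightarrow> \<rho> > 0 \<Longrightarrow> \<rho> * d (f x) (f y) \<le> \<zeta> \<rho> * d x y"
    using assms(5) by blast
  have asymptotic: "(\<lambda>n. d ((f ^^ n) x) ((f ^^ n) y)) \<longlonglongrightarrow> 0" if "x \<in> \<Xi>" "y \<in> \<Xi>" for x y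
    using orbits_asymptotic[OF \<open>Metric_space \<Xi> d\<close> f \<zeta> _ that] contr by blast
  note orbit = funpow_mem_funcset[OF f]
  obtain x where x: "x \<in> \<Xi>"
    using \<open>\<Xi> \<noteq> {}\<close> by blast
  have "(\<lambda>n. d ((f ^^ n) x) ((f ^^ (n + p)) x)) \<longlonglongrightarrow> 0" for p
    using asymptotic[OF x orbit[OF x, of p]] by (simp add: funpow_add)
  then obtain z where lim: "limitin mtopology (\<lambda>n. (f ^^ n) x) z sequentially"
    using assms(4)[of "\<lambda>n. (f ^^ n) x"] orbit[OF x] by auto
  then have z: "z \<in> \<Xi>" and to_z: "(\<lambda>n. d ((f ^^ n) x) z) \<longlonglongrightarrow> 0"
    by (auto simp: limitin_metric_dist_null)
  have fz: "f z \<in> \<Xi>"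
    using f z by auto
  have "f z = z"
  proof -
    have "d z (f z) \<le> d ((f ^^ Suc n) x) z + \<zeta> 1 * d ((f ^^ n) x) z" for n
      using triangle'[of z "(f ^^ Suc n) x" "f z"] contr[OF orbit[OF x, of n] z, of 1]
        orbit[OF x, of "Suc n"] z fz
      by (simp add: commute)
    moreover have "(\<lambda>n. d ((f ^^ Suc n) x) z + \<zeta> 1 * d ((f ^^ n) x) z) \<longlonglongrightarrow> 0"
      using tendsto_add[OF LIMSEQ_Suc[OF to_z] tendsto_mult_right_zero[OF to_z, of "\<zeta> 1"]]
      by simp
    ultimately have "d z (f z) \<le> 0"
      by (intro LIMSEQ_le_const) auto
    then show ?thesis
      using z fz nonneg[of z "f z"] by auto
  qed
  then have z_fixed: "(f ^^ n) z = z" for n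
    by (induction n) auto
  have "limitin mtopology (\<lambda>n. (f ^^ n) y) z sequentially" if "y \<in> \<Xi>" for y
    using asymptotic[OF that z] orbit[OF that] z
    by (simp add: z_fixed limitin_metric_dist_null)
  moreover have "w = z" if w: "w \<in> \<Xi>" "f w = w" for w
  proof -
    have "(f ^^ n) w = w" for n
      using w by (induction n) auto
    then have "(\<lambda>n. d w z) \<longlonglongrightarrow> 0"
      using asymptotic[OF w(1) z] by (simp add: z_fixed)
    then show ?thesis
      using w z by (simp add: LIMSEQ_const_iff)
  qed
  ultimately show ?thesis
    using z \<open>f z = z\<close> by blast
qed

end
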